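(* Let $\tau$ be the substitution on $\{a,b,c\}$ given by $\tau(a)=aabaa$, $\tau(b)=abcab$, $\tau(c)=aabac$. Then $\tau$ is quasi-invertible, and there is a substitution $\tau'$ such that the two-sided subshifts $(X_\tau^{\mathbb Z},\sigma)$ and $(X_{\tau'}^{\mathbb Z},\sigma)$ are topologically conjugate, while the one-sided subshifts $(X_\tau^{\mathbb N},\sigma)$ and $(X_{\tau'}^{\mathbb N},\sigma)$ are not topologically conjugate.
   Context: A substitution on a finite alphabet $\mathcal A$ is a map $\tau:\mathcal A\to\mathcal A^+$ into nonempty finite words, extended to words by concatenation. $\mathcal L_\tau$ is the set of all subwords of the words $\tau^n(a)$, $n\ge1$, $a\in\mathcal A$. For $\mathbb M=\mathbb N$ or $\mathbb Z$, $X_\tau^{\mathbb M}$ is the set of sequences in $\mathcal A^{\mathbb M}$ (product topology) all of whose finite subwords lie in $\mathcal L_\tau$, and $\sigma$ is the left shift, $(\sigma x)_m=x_{m+1}$. A branch point is a point of $X_\tau^{\mathbb N}$ with more than one $\sigma$-preimage in $X_\tau^{\mathbb N}$; $\tau$ is quasi-invertible if $X_\tau^{\mathbb N}$ has exactly one branch point. Two systems $(X,T)$ and $(X',T')$ are topologically conjugate if there is a homeomorphism $f:X\to X'$ with $f\circ T=T'\circ f$. *)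

theory Defs
  imports "HOL-Analysis.Analysis" "HOL-Library.Sublist"
begin

definition substitution :: "'a set \<Rightarrow> ('a \<Rightarrow> 'a list) \<Rightarrow> bool" where
  "substitution A \<tau> \<longleftrightarrow> finite A \<and> (\<forall>a\<in>A. \<tau> a \<noteq> [] \<and> set (\<tau> a) \<subseteq> A)"

definition subst_word :: "('a \<Rightarrow> 'a list) \<Rightarrow> 'a list \<Rightarrow> 'a list" where
  "subst_word \<tau> w = concat (map \<tau> w)"

definition subst_lang :: "'a set \<Rightarrow> ('a \<Rightarrow> 'a list) \<Rightarrow> 'a list set" where
  "subst_lang A \<tau> = {w. \<exists>n\<ge>1. \<exists>a\<in>A. sublist w ((subst_word \<tau> ^^ n) [a])}"

(* The index type 'i is nat for one-sided and int for two-sided sequences. *)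

definition seq_word :: "('i::semiring_1 \<Rightarrow> 'a) \<Rightarrow> 'i \<Rightarrow> nat \<Rightarrow> 'a list" where
  "seq_word x i n = map (\<lambda>k. x (i + of_nat k)) [0..<n]"

definition subshift :: "'a set \<Rightarrow> ('a \<Rightarrow> 'a list) \<Rightarrow> ('i::semiring_1 \<Rightarrow> 'a) set" where
  "subshift A \<tau> = {x. range x \<subseteq> A \<and> (\<forall>i n. seq_word x i n \<in> subst_lang A \<tau>)}"

definition subshift_top ::
    "'a set \<Rightarrow> ('a \<Rightarrow> 'a list) \<Rightarrow> ('i::semiring_1 \<Rightarrow> 'a) topology" where
  "subshift_top A \<tau> =
     subtopology (product_topology (\<lambda>_. discrete_topology A) UNIV) (subshift A \<tau>)"

definition shift :: "('i::semiring_1 \<Rightarrow> 'a) \<Rightarrow> ('i \<Rightarrow> 'a)" where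
  "shift x = (\<lambda>m. x (m + 1))"

definition branch_point :: "'a set \<Rightarrow> ('a \<Rightarrow> 'a list) \<Rightarrow> (nat \<Rightarrow> 'a) \<Rightarrow> bool" where
  "branch_point A \<tau> x \<longleftrightarrow> x \<in> subshift A \<tau> \<and>
     (\<exists>y\<in>subshift A \<tau>. \<exists>z\<in>subshift A \<tau>. y \<noteq> z \<and> shift y = x \<and> shift z = x)"

definition quasi_invertible :: "'a set \<Rightarrow> ('a \<Rightarrow> 'a list) \<Rightarrow> bool" where
  "quasi_invertible A \<tau> \<longleftrightarrow> (\<exists>!x. branch_point A \<tau> x)"

definition top_conjugate ::
    "'x topology \<Rightarrow> ('x \<Rightarrow> 'x) \<Rightarrow> 'y topology \<Rightarrow> ('y \<Rightarrow> 'y) \<Rightarrow> bool" where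
  "top_conjugate X T X' T' \<longleftrightarrow>
     (\<exists>f. homeomorphic_map X X' f \<and> (\<forall>x\<in>topspace X. f (T x) = T' (f x)))"

datatype letter = La | Lb | Lc

fun tau :: "letter \<Rightarrow> letter list" where
  "tau La = [La, La, Lb, La, La]"
| "tau Lb = [La, Lb, Lc, La, Lb]"
| "tau Lc = [La, La, Lb, La, Lc]"

end

(* The last letters of tau La, tau Lb, tau Lc are pairwise distinct and the word bc occurs in
   a concatenation of blocks only inside tau Lb.  Hence cutting a one-sided point into blocks
   is unique, the letter before a branch point x ends a block, and x = tau(x') for another
   branch point x'.  Iterating, x is the fixed point u starting with La; conversely au, bu and
   cu all lie in the subshift.  So the three two-sided points that agree to the right of
   the origin split at one and the same place.  Writing a new letter 3 for each a that is
   preceded by c is a two-sided conjugacy onto another substitution subshift, but it separates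
   cu from au and bu one step earlier than these two are separated, which produces two
   different one-sided branch points. *)
theory Submission
  imports Defs
begin

section \<open>Languages and one-sided points\<close>

lemma subst_word_append: "subst_word t (u @ v) = subst_word t u @ subst_word t v"
  by (simp add: subst_word_def)

lemma subst_lang_sublist:
  assumes "w \<in> subst_lang A t" "sublist v w"
  shows "v \<in> subst_lang A t"
  using assms unfolding subst_lang_def by (blast intro: sublist_order.order_trans)

lemma subst_lang_subst_word:
  assumes "w \<in> subst_lang A t"
  shows "subst_word t w \<in> subst_lang A t"
proof -
  obtain n a where n: "n \<ge> 1" "a \<in> A" "sublist w ((subst_word t ^^ n) [a])"
    using assms by (auto simp: subst_lang_def)
  then obtain p s where "(subst_word t ^^ n) [a] = p @ w @ s"
    by (auto simp: sublist_def)
  then have "(subst_word t ^^ Suc n) [a] = subst_word t p @ subst_word t w @ subst_word t s"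
    by (simp add: subst_word_append)
  then have "sublist (subst_word t w) ((subst_word t ^^ Suc n) [a])"
    by (metis sublist_appendI)
  with n show ?thesis unfolding subst_lang_def by (metis (mono_tags, lifting) le_Suc_eq mem_Collect_eq)
qed

lemma length_seq_word [simp]: "length (seq_word x i n) = n"
  by (simp add: seq_word_def)

lemma seq_word_Suc: "seq_word x i (Suc n) = x i # seq_word x (i + 1) n"
  by (simp add: seq_word_def upt_conv_Cons add.assoc flip: map_Suc_upt del: upt_Suc)

lemma seq_word_0 [simp]: "seq_word x i 0 = []"
  by (simp add: seq_word_def)

lemma seq_word_nat_nth [simp]: "k < n \<Longrightarrow> seq_word x (i::nat) n ! k = x (i + k)"
  by (simp add: seq_word_def)

text \<open>Every window of a one-sided sequence is a suffix of a prefix, and the language is closed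
  under subwords.\<close>

lemma subshift_natI:
  fixes x :: "nat \<Rightarrow> 'a"
  assumes "range x \<subseteq> A" "\<And>n. seq_word x 0 n \<in> subst_lang A t"
  shows "x \<in> subshift A t"
proof -
  have "seq_word x i n \<in> subst_lang A t" for i n
  proof -
    have "seq_word x i n = drop i (seq_word x 0 (i + n))"
      by (rule nth_equalityI) auto
    with assms(2) show ?thesis by (metis subst_lang_sublist sublist_drop)
  qed
  with assms(1) show ?thesis by (auto simp: subshift_def)
qed

lemma shift_in_subshift:
  fixes x :: "'i::semiring_1 \<Rightarrow> 'a"
  assumes "x \<in> subshift A t"
  shows "shift x \<in> subshift A t"
proof -
  have "seq_word (shift x) i n = seq_word x (i + 1) n" for i n
    by (simp add: seq_word_def shift_def ac_simps)
  then show ?thesis using assms by (auto simp: subshift_def shift_def)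
qed

section \<open>Cutting points of the first subshift into blocks\<close>

lemma length_tau [simp]: "length (tau x) = 5"
  by (cases x) auto

lemma length_subst_word_tau [simp]: "length (subst_word tau w) = 5 * length w"
  by (induction w) (auto simp: subst_word_def)

lemma nth_subst_word_tau:
  "i < 5 * length w \<Longrightarrow> subst_word tau w ! i = tau (w ! (i div 5)) ! (i mod 5)"
proof (induction w arbitrary: i)
  case Nil
  then show ?case by simp
next
  case (Cons a w)
  show ?case
  proof (cases "i < 5")
    case True
    then show ?thesis by (simp add: subst_word_def nth_append)
  next
    case False
    then obtain j where j: "i = j + 5" by (metis add.commute le_Suc_ex not_less)
    have "subst_word tau (a # w) ! i = subst_word tau w ! j"
      by (simp add: subst_word_def nth_append j)
    with Cons j show ?thesis by simp
  qed
qed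

lemma tau_nth_0 [simp]: "tau x ! 0 = La"
  by (cases x) auto

text \<open>A block is named by its last letter, so a preimage under \<open>tau\<close> can be read
  off at the block ends.\<close>

lemma tau_nth_4 [simp]: "tau x ! 4 = x"
  by (cases x) auto

text \<open>\<open>tau Lb\<close> contains all three letters. This covers the word left over when
  the only application of \<open>tau\<close> is stripped off, since \<open>subst_lang\<close> starts
  at n = 1.\<close>

lemma singleton_in_lang: "[x] \<in> subst_lang UNIV tau"
proof -
  have "sublist [x] ((subst_word tau ^^ 1) [Lb])"
    by (cases x) (auto simp: subst_word_def sublist_Cons_right)
  then show ?thesis unfolding subst_lang_def by blast
qed

text \<open>The outermost \<open>tau\<close> is stripped off: V starts with the block in which w
  begins, and p is the place inside that block.\<close>

lemma lang_desubstitute: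
  assumes "w \<in> subst_lang UNIV tau"
  shows "\<exists>p<5. \<exists>V\<in>subst_lang UNIV tau. length w + p \<le> 5 * length V \<and>
           (\<forall>i<length w. w ! i = tau (V ! ((i + p) div 5)) ! ((i + p) mod 5))"
proof -
  obtain n a where n: "n \<ge> 1" "sublist w ((subst_word tau ^^ n) [a])"
    using assms by (auto simp: subst_lang_def)
  then obtain m where m: "n = Suc m" by (cases n) auto
  define W where "W = (subst_word tau ^^ m) [a]"
  have W: "W \<in> subst_lang UNIV tau"
  proof (cases m)
    case 0
    then show ?thesis by (simp add: W_def singleton_in_lang)
  next
    case (Suc k)
    then have "1 \<le> m" by simp
    then show ?thesis unfolding W_def subst_lang_def by blast
  qed
  obtain pre suf where eq: "subst_word tau W = pre @ w @ suf"
    using n m by (auto simp: W_def sublist_def)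
  define q where "q = length pre"
  have len: "q + length w \<le> 5 * length W"
    using arg_cong[OF eq, of length] by (simp add: q_def)
  define V where "V = drop (q div 5) W"
  have V: "V \<in> subst_lang UNIV tau"
    unfolding V_def using W subst_lang_sublist sublist_drop by blast
  have q: "q = 5 * (q div 5) + q mod 5" by simp
  have "w ! i = tau (V ! ((i + q mod 5) div 5)) ! ((i + q mod 5) mod 5)" if "i < length w" for i
  proof -
    have shift: "q + i = (i + q mod 5) + q div 5 * 5" by simp
    have "w ! i = subst_word tau W ! (q + i)"
      using that by (simp add: eq q_def nth_append)
    also have "\<dots> = tau (W ! ((q + i) div 5)) ! ((q + i) mod 5)"
      using that len by (intro nth_subst_word_tau) auto
    also have "(q + i) div 5 = q div 5 + (i + q mod 5) div 5"
      by (subst shift) (rule div_mult_self1, simp)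
    also have "(q + i) mod 5 = (i + q mod 5) mod 5"
      by (subst shift) (rule mod_mult_self1)
    also have "W ! (q div 5 + (i + q mod 5) div 5) = V ! ((i + q mod 5) div 5)"
      unfolding V_def using that len by (subst nth_drop) auto
    finally show ?thesis .
  qed
  moreover have "length w + q mod 5 \<le> 5 * length V"
    using len q unfolding V_def length_drop by linarith
  ultimately show ?thesis using V by (intro exI[of _ "q mod 5"]) auto
qed

text \<open>Compactness: one of the five offsets serves all prefixes, and the block names, read at
  the block ends, are then the same for every prefix.\<close>

lemma point_desubstitute:
  fixes x :: "nat \<Rightarrow> letter"
  assumes "x \<in> subshift UNIV tau"
  obtains p v where "p < 5" "v \<in> subshift UNIV tau"
    "\<And>i. x i = tau (v ((i + p) div 5)) ! ((i + p) mod 5)"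
proof -
  define P where "P p n \<longleftrightarrow> (\<exists>V\<in>subst_lang UNIV tau. n + p \<le> 5 * length V \<and>
           (\<forall>i<n. x i = tau (V ! ((i + p) div 5)) ! ((i + p) mod 5)))" for p n
  have ex: "\<exists>p<5. P p n" for n
  proof -
    have "seq_word x 0 n \<in> subst_lang UNIV tau"
      using assms by (auto simp: subshift_def)
    from lang_desubstitute[OF this] show ?thesis by (simp add: P_def)
  qed
  have mono: "P p n" if "P p m" "n \<le> m" for p m n
    using that unfolding P_def by (meson add_le_mono1 le_trans less_le_trans)
  \<comment> \<open>Pigeonhole: if every offset p failed at some length \<open>N p\<close>, none
    would work at the largest of these lengths.\<close>
  have "\<exists>p<5. \<forall>n. P p n"
  proof (rule ccontr)
    assume "\<not> ?thesis"
    then obtain N where N: "\<And>p. p < 5 \<Longrightarrow> \<not> P p (N p)" by metis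
    obtain p where p: "p < 5" "P p (Max (N ` {..<5}))" using ex by blast
    then have "N p \<le> Max (N ` {..<5})" by (intro Max_ge) auto
    with p N mono show False by blast
  qed
  then obtain p where p: "p < 5" "\<And>n. P p n" by blast
  \<comment> \<open>With offset p, block j ends at position 5j + 4 - p; the subtraction never
    truncates because p < 5.\<close>
  define v where "v j = x (5 * j + 4 - p)" for j
  have v: "\<exists>V\<in>subst_lang UNIV tau. m \<le> length V \<and> (\<forall>j<m. V ! j = v j) \<and>
           (\<forall>i<5 * m - p. x i = tau (V ! ((i + p) div 5)) ! ((i + p) mod 5))" for m
  proof -
    obtain V where V: "V \<in> subst_lang UNIV tau" "5 * m - p + p \<le> 5 * length V"
        "\<And>i. i < 5 * m - p \<Longrightarrow> x i = tau (V ! ((i + p) div 5)) ! ((i + p) mod 5)"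
      using p(2)[of "5 * m - p"] unfolding P_def by blast
    have "V ! j = v j" if "j < m" for j
    proof -
      have "5 * j + 4 - p < 5 * m - p" "5 * j + 4 - p + p = 4 + j * 5"
        using that p(1) by auto
      with V(3)[of "5 * j + 4 - p"] show ?thesis by (simp add: v_def)
    qed
    moreover have "m \<le> length V" using V(2) by linarith
    ultimately show ?thesis using V by blast
  qed
  have "v \<in> subshift UNIV tau"
  proof (rule subshift_natI)
    fix m
    obtain V where V: "V \<in> subst_lang UNIV tau" "m \<le> length V" "\<forall>j<m. V ! j = v j"
      using v by blast
    have "seq_word v 0 m = take m V"
      by (rule nth_equalityI) (use V in auto)
    with V(1) show "seq_word v 0 m \<in> subst_lang UNIV tau"
      by (metis subst_lang_sublist sublist_take)
  qed auto
  moreover have "x i = tau (v ((i + p) div 5)) ! ((i + p) mod 5)" for i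
  proof -
    define m where "m = (i + p) div 5 + 1"
    obtain V where V: "\<forall>j<m. V ! j = v j"
        "\<forall>i<5 * m - p. x i = tau (V ! ((i + p) div 5)) ! ((i + p) mod 5)"
      using v[of m] by blast
    have "i + p < 5 * m" using mult_div_mod_eq[of 5 "i + p"] mod_less_divisor[of 5 "i + p"]
      unfolding m_def by simp
    then have "i < 5 * m - p" by linarith
    moreover have "(i + p) div 5 < m" by (simp add: m_def)
    ultimately show ?thesis using V by simp
  qed
  ultimately show thesis using p(1) that by blast
qed

section \<open>The branch point\<close>

lemma b_occurs:
  fixes x :: "nat \<Rightarrow> letter"
  assumes "x \<in> subshift UNIV tau"
  shows "\<exists>j\<ge>1. x j = Lb"
proof -
  obtain p v where p: "p < 5" and x: "\<And>i. x i = tau (v ((i + p) div 5)) ! ((i + p) mod 5)"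
    using point_desubstitute[OF assms] by metis
  \<comment> \<open>Position 5 - p starts block 1, the first block that is certainly complete; every
    block has b at index 1 or 2.\<close>
  have e: "5 - p + 1 + p = 6" "5 - p + 2 + p = 7" using p by auto
  have "x (5 - p + 1) = tau (v 1) ! 1" "x (5 - p + 2) = tau (v 1) ! 2"
    by (simp_all only: x e) simp_all
  then have "x (5 - p + 1) = Lb \<or> x (5 - p + 2) = Lb"
    by (cases "v 1") auto
  then show ?thesis by (metis le_add2 one_le_numeral trans_le_add2)
qed

text \<open>By \<open>b_occurs\<close> some block after the first is \<open>tau Lb\<close>, that is
  abcab. The bound on k places bc in the part that two preimages of a branch point share.\<close>

lemma bc_occurs:
  fixes x :: "nat \<Rightarrow> letter"
  assumes "x \<in> subshift UNIV tau"
  shows "\<exists>k\<ge>1. x k = Lb \<and> x (Suc k) = Lc"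
proof -
  obtain p v where p: "p < 5" "v \<in> subshift UNIV tau"
      and x: "\<And>i. x i = tau (v ((i + p) div 5)) ! ((i + p) mod 5)"
    using point_desubstitute[OF assms] by metis
  obtain j where j: "j \<ge> 1" "v j = Lb" using b_occurs[OF p(2)] by blast
  define k where "k = 5 * j + 1 - p"
  have k: "k + p = 1 + j * 5" "Suc k + p = 2 + j * 5" "k \<ge> 1" using j p by (auto simp: k_def)
  then have "(k + p) div 5 = j" "(k + p) mod 5 = 1" "(Suc k + p) div 5 = j" "(Suc k + p) mod 5 = 2"
    by presburger+
  then have "x k = Lb" "x (Suc k) = Lc"
    unfolding x using j by simp_all
  with k(3) show ?thesis by blast
qed

text \<open>Every block begins with a, so bc never straddles two blocks, and inside a block it can
  only start at index 1. Hence a single occurrence of bc fixes the cutting offset.\<close>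

lemma bc_position:
  assumes "tau (v (n div 5)) ! (n mod 5) = Lb" "tau (v (Suc n div 5)) ! (Suc n mod 5) = Lc"
  shows "n mod 5 = 1"
proof -
  have "n mod 5 < 5" by simp
  then consider "n mod 5 = 0" | "n mod 5 = 1" | "n mod 5 = 2" | "n mod 5 = 3" | "n mod 5 = 4"
    by linarith
  then show ?thesis
  proof cases
    case 3
    then have "Suc n mod 5 = 3" "Suc n div 5 = n div 5" by (simp_all add: mod_Suc div_Suc)
    with 3 assms show ?thesis by (cases "v (n div 5)") auto
  next
    case 4
    then have "Suc n mod 5 = 4" "Suc n div 5 = n div 5" by (simp_all add: mod_Suc div_Suc)
    with 4 assms show ?thesis by (cases "v (n div 5)") auto
  next
    case 5
    then have "Suc n mod 5 = 0" by (simp add: mod_Suc)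
    with assms show ?thesis by simp
  qed (use assms in auto)
qed

lemma branch_point_desubstitute:
  assumes "branch_point UNIV tau x"
  shows "\<exists>x'. branch_point UNIV tau x' \<and> (\<forall>i. x i = tau (x' (i div 5)) ! (i mod 5))"
proof -
  obtain y z where yz: "y \<in> subshift UNIV tau" "z \<in> subshift UNIV tau" "y \<noteq> z"
      "shift y = x" "shift z = x"
    using assms by (auto simp: branch_point_def)
  have ys: "y (Suc i) = x i" for i unfolding yz(4)[symmetric] by (simp add: shift_def)
  have zs: "z (Suc i) = x i" for i unfolding yz(5)[symmetric] by (simp add: shift_def)
  have y0: "y 0 \<noteq> z 0"
  proof
    assume "y 0 = z 0"
    then have "y i = z i" for i by (cases i) (auto simp: ys zs)
    with yz(3) show False by auto
  qed
  obtain p v where p: "p < 5" "v \<in> subshift UNIV tau"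
      and y: "\<And>i. y i = tau (v ((i + p) div 5)) ! ((i + p) mod 5)"
    using point_desubstitute[OF yz(1)] by metis
  obtain q w where q: "q < 5" "w \<in> subshift UNIV tau"
      and z: "\<And>i. z i = tau (w ((i + q) div 5)) ! ((i + q) mod 5)"
    using point_desubstitute[OF yz(2)] by metis
  obtain k where k: "k \<ge> 1" "y k = Lb" "y (Suc k) = Lc" using bc_occurs[OF yz(1)] by blast
  have "z k = Lb" "z (Suc k) = Lc" using k by (cases k; simp add: ys zs)+
  then have "(k + q) mod 5 = 1" using bc_position[of w "k + q"] z[of k] z[of "Suc k"] by simp
  moreover have "(k + p) mod 5 = 1" using bc_position[of v "k + p"] y[of k] y[of "Suc k"] k by simp
  ultimately obtain a b where "k + p = 5 * a + 1" "k + q = 5 * b + 1"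
    by (metis mult_div_mod_eq)
  then have "5 * a + q = 5 * b + p" by linarith
  moreover have "(5 * a + q) mod 5 = q" "(5 * b + p) mod 5 = p" using p(1) q(1) by simp_all
  ultimately have pq: "p = q" by metis
  have v: "v j = y (5 * j + 4 - p)" and w: "w j = z (5 * j + 4 - p)" for j
  proof -
    have e: "5 * j + 4 - p + p = 4 + j * 5" using p(1) by simp
    show "v j = y (5 * j + 4 - p)" "w j = z (5 * j + 4 - p)"
      unfolding y z pq[symmetric] e by simp_all
  qed
  have yz': "y i = z i" if "i > 0" for i using that by (cases i) (auto simp: ys zs)
  \<comment> \<open>For p < 4, block 0 ends at position 4 - p > 0, where y and z agree; the whole
    block is then the same in both, and so is letter 0.\<close>
  have p4: "p = 4"
  proof (rule ccontr)
    assume "p \<noteq> 4"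
    with p(1) have "v 0 = w 0" unfolding v w by (intro yz') auto
    then have "y 0 = z 0" unfolding y z pq[symmetric] using p(1) by simp
    with y0 show False by simp
  qed
  \<comment> \<open>With p = 4 the block ends are the positions 5j, so v and w differ exactly at 0,
    where they are \<open>y 0\<close> and \<open>z 0\<close>.\<close>
  have "shift v = shift w"
    unfolding shift_def v w by (intro ext yz') (simp add: p4)
  moreover have "v \<noteq> w" using v[of 0] w[of 0] y0 p4 by auto
  moreover have "shift v \<in> subshift UNIV tau"
    using p(2) by (rule shift_in_subshift)
  ultimately have "branch_point UNIV tau (shift v)"
    using p(2) q(2) unfolding branch_point_def by metis
  moreover have "x i = tau (shift v (i div 5)) ! (i mod 5)" for i
    unfolding ys[symmetric] y p4 shift_def by (simp add: add.commute)
  ultimately show ?thesis by blast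
qed

section \<open>The fixed point of \<open>tau\<close> and its left extensions\<close>

fun u :: "nat \<Rightarrow> letter" where
  "u n = (if n = 0 then La else tau (u (n div 5)) ! (n mod 5))"

declare u.simps [simp del]

lemma u_0: "u 0 = La"
  by (simp add: u.simps)

text \<open>The recursion for \<open>u\<close> splits off 0 because 0 div 5 = 0; the equation still
  holds there, as \<open>tau La\<close> begins with a. So \<open>u\<close> is fixed by
  \<open>tau\<close>.\<close>

lemma u_desubstitute: "u n = tau (u (n div 5)) ! (n mod 5)"
  by (cases "n = 0") (simp_all add: u_0 u.simps[of n])

text \<open>Strong induction on the position, over all branch points at once: letter n of x depends
  only on letter n div 5 of the branch point x', and letter 0 is a because every block starts with
  a.\<close>

lemma branch_point_unique:
  assumes "branch_point UNIV tau x"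
  shows "x n = u n"
  using assms
proof (induction n arbitrary: x rule: less_induct)
  case (less n)
  obtain x' where x': "branch_point UNIV tau x'" "\<And>i. x i = tau (x' (i div 5)) ! (i mod 5)"
    using branch_point_desubstitute[OF less.prems] by blast
  show ?case
  proof (cases "n = 0")
    case True
    then show ?thesis by (simp add: x'(2) u.simps)
  next
    case False
    then have "x' (n div 5) = u (n div 5)" using less.IH x'(1) by simp
    then show ?thesis by (simp add: x'(2) u_desubstitute[of n])
  qed
qed

lemma subst_word_u: "subst_word tau (seq_word u 0 n) = seq_word u 0 (5 * n)"
proof (rule nth_equalityI)
  fix i assume "i < length (subst_word tau (seq_word u 0 n))"
  then show "subst_word tau (seq_word u 0 n) ! i = seq_word u 0 (5 * n) ! i"
    by (simp add: nth_subst_word_tau u_desubstitute[of i])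
qed simp

text \<open>\<open>tau x\<close> always ends in a followed by x, so applying \<open>tau\<close>
  reproduces the two letters on the left and lengthens the prefix of \<open>u\<close> fivefold. Two
  letters are kept because marking will consume one.\<close>

lemma ax_u_prefix_in_lang: "La # x # seq_word u 0 n \<in> subst_lang UNIV tau"
proof -
  have pow: "La # x # seq_word u 0 (5 ^ k) \<in> subst_lang UNIV tau" for k
  proof (induction k)
    case 0
    \<comment> \<open>The third power is the first to contain aca: in the second power of
      \<open>tau\<close> at a, the letter c occurs only inside bca.\<close>
    have "sublist [La, x, La] ((subst_word tau ^^ 3) [La])"
      by (cases x) (auto simp: subst_word_def sublist_Cons_right numeral_3_eq_3)
    then have "[La, x, La] \<in> subst_lang UNIV tau"
      unfolding subst_lang_def by (metis (mono_tags, lifting) UNIV_I mem_Collect_eq one_le_numeral)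
    then show ?case by (simp add: seq_word_Suc u.simps)
  next
    case (Suc k)
    obtain s where s: "tau x = s @ [La, x]" by (cases x) auto
    have "subst_word tau (La # x # seq_word u 0 (5 ^ k))
        = (tau La @ s) @ La # x # seq_word u 0 (5 ^ Suc k)"
      using subst_word_u[of "5 ^ k"] by (simp add: subst_word_def s)
    then show ?case
      using subst_lang_subst_word[OF Suc] by (metis subst_lang_sublist sublist_append_leftI)
  qed
  have "n \<le> 5 ^ n" by (simp add: less_imp_le less_exp order_less_le_trans[of n "2 ^ n"] power_mono)
  then have "seq_word u 0 n = take n (seq_word u 0 (5 ^ n))"
    by (intro nth_equalityI) (auto simp: less_le_trans)
  then have "La # x # seq_word u 0 n = take (Suc (Suc n)) (La # x # seq_word u 0 (5 ^ n))"
    by simp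
  then show ?thesis using pow by (metis subst_lang_sublist sublist_take)
qed

definition seq_cons :: "'a \<Rightarrow> (nat \<Rightarrow> 'a) \<Rightarrow> nat \<Rightarrow> 'a" where
  "seq_cons a x = case_nat a x"

lemma seq_cons_simps [simp]: "seq_cons a x 0 = a" "seq_cons a x (Suc n) = x n"
  by (simp_all add: seq_cons_def)

lemma shift_seq_cons [simp]: "shift (seq_cons a x) = x"
  by (simp add: shift_def)

lemma seq_word_seq_cons: "seq_word (seq_cons a x) 0 (Suc n) = a # seq_word x 0 n"
proof (rule nth_equalityI)
  fix i assume "i < length (seq_word (seq_cons a x) 0 (Suc n))"
  then show "seq_word (seq_cons a x) 0 (Suc n) ! i = (a # seq_word x 0 n) ! i"
    by (cases i) auto
qed simp

lemma axu_in_subshift: "seq_cons La (seq_cons x u) \<in> subshift UNIV tau"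
proof (rule subshift_natI)
  fix n
  have "seq_word (seq_cons La (seq_cons x u)) 0 n
      = take n (seq_word (seq_cons La (seq_cons x u)) 0 (Suc (Suc n)))"
    by (rule nth_equalityI) auto
  then show "seq_word (seq_cons La (seq_cons x u)) 0 n \<in> subst_lang UNIV tau"
    by (metis ax_u_prefix_in_lang seq_word_seq_cons subst_lang_sublist sublist_take)
qed auto

lemma xu_in_subshift: "seq_cons x u \<in> subshift UNIV tau"
  using shift_in_subshift[OF axu_in_subshift] by simp

lemma quasi_invertible_tau: "quasi_invertible UNIV tau"
proof -
  have "u \<in> subshift UNIV tau" using shift_in_subshift[OF xu_in_subshift] by simp
  moreover have "seq_cons La u \<noteq> seq_cons Lb u" by (metis letter.distinct(1) seq_cons_simps(1))
  ultimately have "branch_point UNIV tau u"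
    unfolding branch_point_def using xu_in_subshift shift_seq_cons by metis
  then show ?thesis unfolding quasi_invertible_def
    by (intro ex1I[of "branch_point UNIV tau" u] ext branch_point_unique)
qed

section \<open>The second subshift\<close>

text \<open>The letters 0, 1, 2 stand for a, b, c and 3 for an a preceded by c. The image of 3
  begins with 3 because the image of a preceding 2 ends in 2.\<close>

definition tau' :: "nat \<Rightarrow> nat list" where
  "tau' n = [[0,0,1,0,0], [0,1,2,3,1], [0,0,1,0,2], [3,0,1,0,0]] ! n"

definition alph :: "nat set" where
  "alph = {0, 1, 2, 3}"

section \<open>Marking finite words\<close>

fun mark :: "bool \<Rightarrow> letter \<Rightarrow> nat" where
  "mark p La = (if p then 3 else 0)"
| "mark p Lb = 1"
| "mark p Lc = 2"

definition unmark :: "nat \<Rightarrow> letter" where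
  "unmark n = (if n = 1 then Lb else if n = 2 then Lc else La)"

(* The flag says whether the preceding letter is c. *)
fun mark_word :: "bool \<Rightarrow> letter list \<Rightarrow> nat list" where
  "mark_word p [] = []"
| "mark_word p (x # w) = mark p x # mark_word (x = Lc) w"

(* Marking intertwines tau and tau' only on words in which each c is followed by a,
   since 3 (a preceded by c) is the only letter that remembers its left neighbour. *)
fun markable :: "bool \<Rightarrow> letter list \<Rightarrow> bool" where
  "markable p [] \<longleftrightarrow> True"
| "markable p (x # w) \<longleftrightarrow> (p \<longrightarrow> x = La) \<and> markable (x = Lc) w"

lemma unmark_mark [simp]: "unmark (mark p x) = x"
  by (cases x) (auto simp: unmark_def)

lemma mark_in_alph [simp]: "mark p x \<in> alph"
  by (cases x) (auto simp: alph_def)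

lemma map_unmark [simp]: "map unmark (mark_word p w) = w"
  by (induction w arbitrary: p) auto

lemma length_mark_word [simp]: "length (mark_word p w) = length w"
  by (induction w arbitrary: p) auto

lemma take_mark_word: "take n (mark_word p w) = mark_word p (take n w)"
  by (induction w arbitrary: p n) (auto simp: take_Cons' )

text \<open>The flag q depends on the last letter dropped, which the remaining word no longer shows;
  hence the existential flags below.\<close>

lemma drop_mark_word: "\<exists>q. drop n (mark_word p w) = mark_word q (drop n w)"
  by (induction w arbitrary: p n) (auto simp: drop_Cons')

text \<open>The last letter of \<open>tau x\<close> is x, so the flag passes from block to block as
  it does from letter to letter. Each block starts with a, so a c that ends a block is again
  followed only by a.\<close>

lemma subst_mark_word:
  assumes "markable p w"
  shows "markable p (subst_word tau w) \<and>
         subst_word tau' (mark_word p w) = mark_word p (subst_word tau w)"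
  using assms
proof (induction w arbitrary: p)
  case Nil
  then show ?case by (simp add: subst_word_def)
next
  case (Cons x w)
  then show ?case by (cases x) (auto simp: subst_word_def tau'_def)
qed

lemma funpow_subst_mark_word:
  assumes "markable p w"
  shows "markable p ((subst_word tau ^^ n) w) \<and>
         (subst_word tau' ^^ n) (mark_word p w) = mark_word p ((subst_word tau ^^ n) w)"
  using assms by (induction n) (auto simp: subst_mark_word)

lemma mark_word_in_lang:
  assumes "w \<in> subst_lang UNIV tau"
  shows "\<exists>p. mark_word p w \<in> subst_lang alph tau'"
proof -
  obtain n a where n: "n \<ge> 1" "sublist w ((subst_word tau ^^ n) [a])"
    using assms by (auto simp: subst_lang_def)
  then obtain s t where w: "(subst_word tau ^^ n) [a] = s @ w @ t" by (auto simp: sublist_def)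
  have eq: "(subst_word tau' ^^ n) [mark False a] = mark_word False (s @ w @ t)"
    using funpow_subst_mark_word[of False "[a]" n] w by simp
  obtain p where p: "drop (length s) (mark_word False (s @ w @ t)) = mark_word p (w @ t)"
    using drop_mark_word[of "length s" False "s @ w @ t"] by auto
  have "mark_word p w = take (length w) (mark_word p (w @ t))" by (simp add: take_mark_word)
  then have "sublist (mark_word p w) ((subst_word tau' ^^ n) [mark False a])"
    unfolding eq by (metis p sublist_drop sublist_order.order_trans sublist_take)
  then show ?thesis using n(1) mark_in_alph unfolding subst_lang_def by blast
qed

lemma lang'_is_marked:
  assumes "w' \<in> subst_lang alph tau'"
  shows "\<exists>p. \<exists>w\<in>subst_lang UNIV tau. w' = mark_word p w"
proof -
  obtain n e where n: "n \<ge> 1" "e \<in> alph" "sublist w' ((subst_word tau' ^^ n) [e])"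
    using assms by (auto simp: subst_lang_def)
  \<comment> \<open>The letter 3 must be read as an a with the flag set, every other letter with the
    flag unset.\<close>
  have "\<exists>p x. e = mark p x \<and> markable p [x]"
  proof (cases "e = 3")
    case True
    then show ?thesis by (intro exI[of _ True] exI[of _ La]) auto
  next
    case False
    then have "e = mark False (unmark e)" using n(2) by (auto simp: alph_def unmark_def)
    then show ?thesis by (intro exI[of _ False] exI[of _ "unmark e"]) auto
  qed
  then obtain p x where e: "e = mark p x" "markable p [x]" by blast
  define W where "W = (subst_word tau ^^ n) [x]"
  have W: "W \<in> subst_lang UNIV tau" using n(1) unfolding W_def subst_lang_def by blast
  have "(subst_word tau' ^^ n) [e] = mark_word p W"
    using funpow_subst_mark_word[OF e(2), of n] e(1) by (simp add: W_def)
  then obtain s t where st: "mark_word p W = s @ w' @ t" using n(3) by (auto simp: sublist_def)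
  then have "w' = take (length w') (drop (length s) (mark_word p W))" by simp
  moreover obtain q where "drop (length s) (mark_word p W) = mark_word q (drop (length s) W)"
    using drop_mark_word by blast
  ultimately have "w' = mark_word q (take (length w') (drop (length s) W))"
    by (simp add: take_mark_word)
  moreover have "take (length w') (drop (length s) W) \<in> subst_lang UNIV tau"
    using W by (meson subst_lang_sublist sublist_drop sublist_take)
  ultimately show ?thesis by blast
qed

text \<open>Entry i marks the letter at i + 1 by looking back to i, so the map makes sense on
  one-sided sequences too. There the first letter survives only as the information whether it is c,
  and injectivity is lost.\<close>

definition mark_seq :: "('i::semiring_1 \<Rightarrow> letter) \<Rightarrow> 'i \<Rightarrow> nat" where
  "mark_seq x i = mark (x i = Lc) (x (i + 1))"

lemma mark_word_seq_word: "mark_word (x i = Lc) (seq_word x (i + 1) n) = seq_word (mark_seq x) i n"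
  by (induction n arbitrary: i) (auto simp: seq_word_Suc mark_seq_def)

lemma mark_seq_in_subshift:
  fixes x :: "'i::semiring_1 \<Rightarrow> letter"
  assumes "x \<in> subshift UNIV tau"
  shows "mark_seq x \<in> subshift alph tau'"
proof -
  have "seq_word (mark_seq x) i n \<in> subst_lang alph tau'" for i n
  proof -
    \<comment> \<open>The window has one extra letter on the left: its own flag p is unknown, but it
      supplies the flag of the next letter and is then dropped.\<close>
    have "seq_word x i (Suc n) \<in> subst_lang UNIV tau" using assms by (simp add: subshift_def)
    from mark_word_in_lang[OF this] obtain p
      where "mark p (x i) # seq_word (mark_seq x) i n \<in> subst_lang alph tau'"
      by (auto simp: seq_word_Suc mark_word_seq_word)
    moreover have "sublist (seq_word (mark_seq x) i n) (mark p (x i) # seq_word (mark_seq x) i n)"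
      by (simp add: sublist_Cons_right)
    ultimately show ?thesis by (rule subst_lang_sublist)
  qed
  then show ?thesis by (auto simp: subshift_def mark_seq_def)
qed

lemma shift_mark_seq: "shift (mark_seq x) = mark_seq (shift x)"
  by (rule ext) (simp add: shift_def mark_seq_def)

text \<open>The image of \<open>u\<close> is preceded by 0 and by 3, coming from au and cu. The
  common image of au and bu is preceded by 0 and by 1, coming from aau and abu.\<close>

lemma branch_points_tau':
  "\<exists>x y. branch_point alph tau' x \<and> branch_point alph tau' y \<and> x \<noteq> y"
proof -
  let ?m = "mark_seq :: (nat \<Rightarrow> letter) \<Rightarrow> nat \<Rightarrow> nat"
  have sh: "shift (?m (seq_cons a x)) = ?m x" for a x by (simp add: shift_mark_seq)
  have u: "u 0 = La" "u 1 = La" "u 2 = Lb"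
    by (simp_all add: u.simps)
  have mem: "?m (seq_cons a u) \<in> subshift alph tau'"
      "?m (seq_cons La (seq_cons a u)) \<in> subshift alph tau'" for a
    by (simp_all add: mark_seq_in_subshift xu_in_subshift axu_in_subshift)
  have memu: "?m u \<in> subshift alph tau'"
    using shift_in_subshift[OF mem(1)[of La]] by (simp add: sh)
  have "?m (seq_cons La u) 0 \<noteq> ?m (seq_cons Lc u) 0"
    by (simp add: mark_seq_def u)
  then have 1: "branch_point alph tau' (?m u)"
    unfolding branch_point_def using memu mem(1) sh by metis
  have same: "?m (seq_cons La u) = ?m (seq_cons Lb u)"
  proof
    fix i show "?m (seq_cons La u) i = ?m (seq_cons Lb u) i"
      by (cases i) (simp_all add: mark_seq_def)
  qed
  have "?m (seq_cons La (seq_cons La u)) 0 \<noteq> ?m (seq_cons La (seq_cons Lb u)) 0"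
    by (simp add: mark_seq_def)
  then have 2: "branch_point alph tau' (?m (seq_cons La u))"
    unfolding branch_point_def using mem sh same by metis
  \<comment> \<open>These entries are the marks of \<open>u 2\<close>, which is b, and of
    \<open>u 1\<close>, which is a.\<close>
  have "?m u 1 \<noteq> ?m (seq_cons La u) 1"
    using u by (simp add: mark_seq_def numeral_2_eq_2)
  with 1 2 show ?thesis by metis
qed

section \<open>The two conjugacy statements\<close>

lemma topspace_subshift_top [simp]: "topspace (subshift_top A t) = subshift A t"
  by (auto simp: subshift_top_def subshift_def PiE_UNIV_domain)

lemma continuous_map_subshift_coordinate:
  "continuous_map (subshift_top A t) (discrete_topology A) (\<lambda>x. x i)"
  unfolding subshift_top_def
  by (intro continuous_map_from_subtopology continuous_map_product_projection) simp

lemma continuous_map_into_subshift: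
  assumes "\<And>i. continuous_map X (discrete_topology A) (\<lambda>x. f x i)"
    and "f \<in> topspace X \<rightarrow> subshift A t"
  shows "continuous_map X (subshift_top A t) f"
  unfolding subshift_top_def using assms
  by (simp add: continuous_map_in_subtopology continuous_map_componentwise_UNIV image_subset_iff_funcset)

lemma conjugate_two_sided:
  "top_conjugate (subshift_top UNIV tau :: (int \<Rightarrow> letter) topology) shift
     (subshift_top alph tau' :: (int \<Rightarrow> nat) topology) shift"
proof -
  let ?X = "subshift_top UNIV tau :: (int \<Rightarrow> letter) topology"
  let ?Y = "subshift_top alph tau' :: (int \<Rightarrow> nat) topology"
  \<comment> \<open>The displacement by one place is undone by reading one place to the left, which
    is always possible only on two-sided sequences.\<close>
  define g :: "(int \<Rightarrow> nat) \<Rightarrow> int \<Rightarrow> letter" where "g y i = unmark (y (i - 1))" for y i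
  have g: "g y \<in> subshift UNIV tau" if "y \<in> subshift alph tau'" for y
  proof -
    have "seq_word (g y) i n \<in> subst_lang UNIV tau" for i n
    proof -
      have "seq_word y (i - 1) n \<in> subst_lang alph tau'" using that by (simp add: subshift_def)
      then obtain p w where "w \<in> subst_lang UNIV tau" "seq_word y (i - 1) n = mark_word p w"
        using lang'_is_marked by blast
      moreover have "seq_word (g y) i n = map unmark (seq_word y (i - 1) n)"
        by (simp add: seq_word_def g_def algebra_simps)
      ultimately show ?thesis by simp
    qed
    then show ?thesis by (simp add: subshift_def)
  qed
  have mg: "mark_seq (g y) = y" if "y \<in> subshift alph tau'" for y
  proof
    fix i
    \<comment> \<open>The flag of the first letter is unknown, but the second letter of a marked
      pair is determined by the unmarked pair.\<close>
    have "seq_word y (i - 1) 2 \<in> subst_lang alph tau'" using that by (simp add: subshift_def)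
    then obtain p w where w: "[y (i - 1), y i] = mark_word p w"
      using lang'_is_marked by (auto simp: numeral_2_eq_2 seq_word_Suc) blast
    then have "w = [unmark (y (i - 1)), unmark (y i)]"
      using map_unmark[of p w] by (simp flip: w)
    moreover have "[a, b] = mark_word p [c, d] \<Longrightarrow> mark (c = Lc) d = b" for a b c d by simp
    ultimately have "mark (unmark (y (i - 1)) = Lc) (unmark (y i)) = y i" using w by blast
    then show "mark_seq (g y) i = y i" by (simp add: mark_seq_def g_def)
  qed
  have gm: "g (mark_seq x) = x" for x
    by (auto simp: g_def mark_seq_def)
  have "continuous_map ?X ?Y mark_seq"
  proof (rule continuous_map_into_subshift)
    fix i :: int
    \<comment> \<open>Coordinate i of the image depends only on two coordinates of x, and every map
      between discrete spaces is continuous.\<close>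
    have pair: "continuous_map ?X (discrete_topology (UNIV \<times> UNIV)) (\<lambda>x. (x i, x (i + 1)))"
      unfolding prod_topology_discrete_topology continuous_map_pairwise o_def
      by (simp add: continuous_map_subshift_coordinate)
    have "continuous_map (discrete_topology (UNIV \<times> UNIV)) (discrete_topology alph)
        (\<lambda>(a, b). mark (a = Lc) b)"
      by auto
    from continuous_map_compose[OF pair this]
    show "continuous_map ?X (discrete_topology alph) (\<lambda>x. mark_seq x i)"
      by (simp add: o_def mark_seq_def)
  qed (auto simp: mark_seq_in_subshift)
  moreover have "continuous_map ?Y ?X g"
  proof (rule continuous_map_into_subshift)
    fix i :: int
    have "continuous_map (discrete_topology alph) (discrete_topology UNIV) unmark" by auto
    from continuous_map_compose[OF continuous_map_subshift_coordinate this]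
    show "continuous_map ?Y (discrete_topology UNIV) (\<lambda>y. g y i)"
      by (simp add: o_def g_def)
  qed (auto simp: g)
  ultimately have "homeomorphic_maps ?X ?Y mark_seq g"
    by (simp add: homeomorphic_maps_def mg gm)
  then show ?thesis unfolding top_conjugate_def
    using homeomorphic_map_maps shift_mark_seq by metis
qed

text \<open>The inverse of a conjugacy carries distinct preimages to distinct preimages. This
  direction sends the two branch points of the second subshift into the single one of the
  first.\<close>

lemma top_conjugate_branch_points:
  assumes "top_conjugate (subshift_top A t :: (nat \<Rightarrow> 'a) topology) shift
             (subshift_top B s :: (nat \<Rightarrow> 'b) topology) shift"
  shows "\<exists>g. inj_on g (Collect (branch_point B s)) \<and>
             g ` Collect (branch_point B s) \<subseteq> Collect (branch_point A t)"
proof -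
  obtain f :: "(nat \<Rightarrow> 'a) \<Rightarrow> nat \<Rightarrow> 'b" where f: "homeomorphic_map (subshift_top A t) (subshift_top B s) f"
      and sh: "\<And>x. x \<in> subshift A t \<Longrightarrow> f (shift x) = shift (f x)"
    using assms by (auto simp: top_conjugate_def)
  have bij: "inj_on f (subshift A t)" "f ` subshift A t = subshift B s"
    using f homeomorphic_imp_injective_map homeomorphic_imp_surjective_map by fastforce+
  define g where "g = inv_into (subshift A t) f"
  have g: "g y \<in> subshift A t" "f (g y) = y" if "y \<in> subshift B s" for y
    using that bij(2) unfolding g_def by (metis inv_into_into, metis f_inv_into_f)
  have gsh: "shift (g y) = g (shift y)" if "y \<in> subshift B s" for y
  proof -
    have "f (shift (g y)) = shift y" using sh[OF g(1)[OF that]] g(2)[OF that] by simp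
    then show ?thesis
      using g[OF shift_in_subshift[OF that]] shift_in_subshift[OF g(1)[OF that]] bij(1)
      by (metis inj_onD)
  qed
  have "branch_point A t (g y)" if br: "branch_point B s y" for y
  proof -
    obtain y1 y2 where y: "y1 \<in> subshift B s" "y2 \<in> subshift B s" "y1 \<noteq> y2"
        "shift y1 = y" "shift y2 = y" "y \<in> subshift B s"
      using br by (auto simp: branch_point_def)
    then have "g y1 \<noteq> g y2" using g(2) by metis
    with y g(1) gsh show ?thesis unfolding branch_point_def by metis
  qed
  moreover have "inj_on g (Collect (branch_point B s))"
    by (rule inj_onI) (metis branch_point_def g(2) mem_Collect_eq)
  ultimately show ?thesis by blast
qed

lemma not_conjugate_one_sided:
  "\<not> top_conjugate (subshift_top UNIV tau :: (nat \<Rightarrow> letter) topology) shift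
     (subshift_top alph tau' :: (nat \<Rightarrow> nat) topology) shift"
proof
  assume "top_conjugate (subshift_top UNIV tau :: (nat \<Rightarrow> letter) topology) shift
     (subshift_top alph tau' :: (nat \<Rightarrow> nat) topology) shift"
  from top_conjugate_branch_points[OF this] obtain g
    where g: "inj_on g (Collect (branch_point alph tau'))"
      "g ` Collect (branch_point alph tau') \<subseteq> Collect (branch_point UNIV tau)" by blast
  obtain x y where xy: "branch_point alph tau' x" "branch_point alph tau' y" "x \<noteq> y"
    using branch_points_tau' by blast
  then have "g x = g y"
    using g(2) quasi_invertible_tau unfolding quasi_invertible_def by blast
  with xy g(1) show False by (auto dest: inj_onD)
qed

(* HOL cannot quantify over types inside a formula, so the alphabet of the second
   substitution is an arbitrary finite set of naturals. *)
theorem mainTheorem6: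
  shows "substitution UNIV tau \<and> quasi_invertible UNIV tau \<and>
    (\<exists>(A' :: nat set) (\<tau>' :: nat \<Rightarrow> nat list). substitution A' \<tau>' \<and>
       top_conjugate
         (subshift_top UNIV tau :: (int \<Rightarrow> letter) topology) shift
         (subshift_top A' \<tau>' :: (int \<Rightarrow> nat) topology) shift \<and>
       \<not> top_conjugate
         (subshift_top UNIV tau :: (nat \<Rightarrow> letter) topology) shift
         (subshift_top A' \<tau>' :: (nat \<Rightarrow> nat) topology) shift)"
proof -
  have "x = La \<or> x = Lb \<or> x = Lc" for x by (cases x) auto
  then have "finite (UNIV :: letter set)"
    by (intro finite_subset[of UNIV "{La, Lb, Lc}"]) auto
  moreover have "tau a \<noteq> []" for a by (cases a) auto
  ultimately have "substitution UNIV tau" by (simp add: substitution_def)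
  moreover have "substitution alph tau'" by (simp add: substitution_def alph_def tau'_def)
  ultimately show ?thesis
    using quasi_invertible_tau conjugate_two_sided not_conjugate_one_sided by blast
qed

end
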